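(* Let $A$ be a set, let $L\subseteq A^*$ be a language and let $\mathcal{L}\colon\mathcal{O}_{\mathsf{Mon}}\to\mathsf{Set}$ be the functor encoding $L$. The minimal $(\mathcal{I}_{\mathsf{Mon}},\mathsf{Set},1,2)$-automaton $\mathsf{Min}(\mathcal{L})$ accepting $\mathcal{L}$ corresponds to the syntactic monoid $\mathsf{Syn}(L)$ of $L$: under the equivalence between $(\mathcal{I}_{\mathsf{Mon}},\mathsf{Set},1,2)$-automata and $A^*$-biaction recognizers, $\mathsf{Min}(\mathcal{L})$ corresponds (up to isomorphism) to the $A^*$-biaction recognizer underlying the monoid recognizer given by the quotient morphism $A^*\to\mathsf{Syn}(L)$ and the image of $L$.
   Context: The category $\mathcal{I}_{\mathsf{Mon}}$ has three objects $\mathsf{in},\mathsf{states},\mathsf{out}$. Its non-identity arrows are among: $\mathtt{w}\colon\mathsf{in}\to\mathsf{states}$ and $\overline{\mathtt{w}}\colon\mathsf{in}\to\mathsf{out}$, one of each for every $w\in A^*$; and $\mathtt{u}\square\mathtt{v}\colon\mathsf{states}\to\mathsf{states}$ and $\overline{\mathtt{u}\square\mathtt{v}}\colon\mathsf{states}\to\mathsf{out}$, one of each for every $(u,v)\in A^*\times A^*$ (with $\varepsilon\square\varepsilon$ the identity of $\mathsf{states}$). Composition is substitution for $\square$: $(\mathtt{u}\square\mathtt{v})\circ\mathtt{w}=\mathtt{uwv}$, $(\mathtt{u'}\square\mathtt{v'})\circ(\mathtt{u}\square\mathtt{v})=\mathtt{u'u}\square\mathtt{vv'}$, $\overline{\mathtt{u}\square\mathtt{v}}\circ\mathtt{w}=\overline{\mathtt{uwv}}$,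 $\overline{\mathtt{u'}\square\mathtt{v'}}\circ(\mathtt{u}\square\mathtt{v})=\overline{\mathtt{u'u}\square\mathtt{vv'}}$. $\mathcal{O}_{\mathsf{Mon}}$ is the full subcategory on $\mathsf{in},\mathsf{out}$, with inclusion $\iota$. Let $1=\{0\}$, $2=\{0,1\}$. The functor $\mathcal{L}$ encoding $L$ sends $\mathsf{in}$ to $1$, $\mathsf{out}$ to $2$, and $\mathcal{L}(\overline{\mathtt{w}})(0)=1$ iff $w\in L$. A $(\mathcal{I}_{\mathsf{Mon}},\mathsf{Set},1,2)$-automaton is a functor $\mathcal{A}\colon\mathcal{I}_{\mathsf{Mon}}\to\mathsf{Set}$ with $\mathcal{A}(\mathsf{in})=1$, $\mathcal{A}(\mathsf{out})=2$; it accepts $\mathcal{L}$ if $\mathcal{A}\circ\iota=\mathcal{L}$. Morphisms are natural transformations that are identities at $\mathsf{in}$ and $\mathsf{out}$. $\mathsf{Min}(\mathcal{L})$ is the automaton obtained by the (componentwise) surjection–injection factorization of the unique morphism from the initial automaton accepting $\mathcal{L}$ to the final automaton accepting $\mathcal{L}$. An $A^*$-biaction is a set $X$ with commuting left and right $A^*$-actions. An $A^*$-biaction recognizer is a pair $(\phi\colon A^*\to X,\ P\subseteq X)$ with $\phi$ a morphism of $A^*$-biactions and $P$ a subset; it recognizes $\{w\mid\phi(w)\in P\}$. The automaton $\mathcal{A}$ corresponds to the recognizer with $X=\mathcal{A}(\mathsf{states})$, $u\cdot x=\mathcal{A}(\mathtt{u}\square\varepsilon)(x)$, $x\cdot v=\mathcal{A}(\varepsilon\square\mathtt{v})(x)$,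 $\phi(w)=\mathcal{A}(\mathtt{w})(0)$, and $P$ the subset with characteristic function $\mathcal{A}(\overline{\varepsilon\square\varepsilon})$. A monoid recognizer is a pair $(\phi\colon A^*\to M,\ P\subseteq M)$ with $\phi$ a monoid morphism; it is an $A^*$-biaction recognizer via $u\cdot m=\phi(u)m$, $m\cdot v=m\phi(v)$. The syntactic monoid $\mathsf{Syn}(L)$ is the quotient of $A^*$ by the congruence $w\sim_L w'$ iff for all $u,v\in A^*$: $uwv\in L\Leftrightarrow uw'v\in L$. *)

theory Defs
  imports "HOL-Algebra.Group" "HOL-Library.FuncSet"
begin

section \<open>Categories, functors, natural transformations\<close>

text \<open>\<open>cmp C g f\<close> is the composite \<open>g \<circ> f\<close>; it is only meaningful when \<open>tgt C f = src C g\<close>.\<close>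

record ('o, 'm) cat =
  Ob :: "'o set"
  Ar :: "'m set"
  src :: "'m \<Rightarrow> 'o"
  tgt :: "'m \<Rightarrow> 'o"
  ident :: "'o \<Rightarrow> 'm"
  cmp :: "'m \<Rightarrow> 'm \<Rightarrow> 'm"

definition is_category :: "('o, 'm) cat \<Rightarrow> bool" where
  "is_category C \<longleftrightarrow>
     (\<forall>f\<in>Ar C. src C f \<in> Ob C \<and> tgt C f \<in> Ob C) \<and>
     (\<forall>X\<in>Ob C. ident C X \<in> Ar C \<and> src C (ident C X) = X \<and> tgt C (ident C X) = X) \<and>
     (\<forall>f\<in>Ar C. \<forall>g\<in>Ar C. tgt C f = src C g \<longrightarrow>
        cmp C g f \<in> Ar C \<and> src C (cmp C g f) = src C f \<and> tgt C (cmp C g f) = tgt C g) \<and>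
     (\<forall>f\<in>Ar C. cmp C f (ident C (src C f)) = f \<and> cmp C (ident C (tgt C f)) f = f) \<and>
     (\<forall>f\<in>Ar C. \<forall>g\<in>Ar C. \<forall>h\<in>Ar C. tgt C f = src C g \<longrightarrow> tgt C g = src C h \<longrightarrow>
        cmp C h (cmp C g f) = cmp C (cmp C h g) f)"

definition full_subcat :: "('o, 'm) cat \<Rightarrow> 'o set \<Rightarrow> ('o, 'm) cat" where
  "full_subcat C S =
     C\<lparr>Ob := Ob C \<inter> S, Ar := {f \<in> Ar C. src C f \<in> S \<and> tgt C f \<in> S}\<rparr>"

record ('o, 'm, 'p, 'n) func =
  fob :: "'o \<Rightarrow> 'p"
  far :: "'m \<Rightarrow> 'n"

definition is_functor ::
  "('o, 'm) cat \<Rightarrow> ('p, 'n) cat \<Rightarrow> ('o, 'm, 'p, 'n) func \<Rightarrow> bool" where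
  "is_functor C D F \<longleftrightarrow>
     (\<forall>X\<in>Ob C. fob F X \<in> Ob D) \<and>
     (\<forall>f\<in>Ar C. far F f \<in> Ar D \<and>
        src D (far F f) = fob F (src C f) \<and> tgt D (far F f) = fob F (tgt C f)) \<and>
     (\<forall>X\<in>Ob C. far F (ident C X) = ident D (fob F X)) \<and>
     (\<forall>f\<in>Ar C. \<forall>g\<in>Ar C. tgt C f = src C g \<longrightarrow>
        far F (cmp C g f) = cmp D (far F g) (far F f))"

definition func_comp ::
  "('p, 'n, 'q, 'k) func \<Rightarrow> ('o, 'm, 'p, 'n) func \<Rightarrow> ('o, 'm, 'q, 'k) func" where
  "func_comp G F = \<lparr>fob = fob G \<circ> fob F, far = far G \<circ> far F\<rparr>"

text \<open>Equality of functors with source \<open>C\<close>: the values of the underlying total functions outside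
  \<open>C\<close> are irrelevant.\<close>

definition func_eq ::
  "('o, 'm) cat \<Rightarrow> ('o, 'm, 'p, 'n) func \<Rightarrow> ('o, 'm, 'p, 'n) func \<Rightarrow> bool" where
  "func_eq C F G \<longleftrightarrow> (\<forall>X\<in>Ob C. fob F X = fob G X) \<and> (\<forall>f\<in>Ar C. far F f = far G f)"

definition is_nat_trans ::
  "('o, 'm) cat \<Rightarrow> ('p, 'n) cat \<Rightarrow> ('o, 'm, 'p, 'n) func \<Rightarrow> ('o, 'm, 'p, 'n) func
     \<Rightarrow> ('o \<Rightarrow> 'n) \<Rightarrow> bool" where
  "is_nat_trans C D F G \<eta> \<longleftrightarrow>
     (\<forall>X\<in>Ob C. \<eta> X \<in> Ar D \<and> src D (\<eta> X) = fob F X \<and> tgt D (\<eta> X) = fob G X) \<and>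
     (\<forall>f\<in>Ar C. cmp D (far G f) (\<eta> (src C f)) = cmp D (\<eta> (tgt C f)) (far F f))"

section \<open>The category of sets\<close>

text \<open>Sets are the subsets of a universe type \<open>'u\<close>. A morphism carries its domain and codomain, and
  its underlying function is extensional, so that equal functions are equal arrows.\<close>

datatype 'u sfun = SFun (sdom: "'u set") (sapp: "'u \<Rightarrow> 'u") (scod: "'u set")

definition Set_cat :: "('u set, 'u sfun) cat" where
  "Set_cat =
     \<lparr>Ob = UNIV,
      Ar = {f. sapp f \<in> sdom f \<rightarrow>\<^sub>E scod f},
      src = sdom,
      tgt = scod,
      ident = (\<lambda>X. SFun X (\<lambda>x\<in>X. x) X),
      cmp = (\<lambda>g f. SFun (sdom f) (compose (sdom f) (sapp g) (sapp f)) (scod g))\<rparr>"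

lemma Set_cat_sel:
  "Ob Set_cat = UNIV"
  "f \<in> Ar Set_cat \<longleftrightarrow> sapp f \<in> sdom f \<rightarrow>\<^sub>E scod f"
  "src Set_cat = sdom"
  "tgt Set_cat = scod"
  "ident Set_cat X = SFun X (\<lambda>x\<in>X. x) X"
  "cmp Set_cat g f = SFun (sdom f) (compose (sdom f) (sapp g) (sapp f)) (scod g)"
  by (simp_all add: Set_cat_def)

lemma is_category_Set_cat: "is_category (Set_cat :: ('u set, 'u sfun) cat)"
proof -
  have closed: "cmp Set_cat g f \<in> Ar Set_cat"
    if "f \<in> Ar Set_cat" "g \<in> Ar Set_cat" "tgt Set_cat f = src Set_cat g" for f g :: "'u sfun"
    using that by (force simp: Set_cat_sel compose_def)
  have assoc: "cmp Set_cat h (cmp Set_cat g f) = cmp Set_cat (cmp Set_cat h g) f"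
    if "f \<in> Ar Set_cat" "tgt Set_cat f = src Set_cat g" for f g h :: "'u sfun"
    using that by (force simp: Set_cat_sel compose_def intro!: restrict_ext)
  have right: "cmp Set_cat f (ident Set_cat (src Set_cat f)) = f"
    and left: "cmp Set_cat (ident Set_cat (tgt Set_cat f)) f = f"
    if "f \<in> Ar Set_cat" for f :: "'u sfun"
    using that compose_Id[of "sapp f" "sdom f" "scod f"] Id_compose[of "sapp f" "sdom f" "scod f"]
    by (simp_all add: Set_cat_sel PiE_iff Pi_iff)
  have "ident Set_cat X \<in> Ar Set_cat" for X :: "'u set"
    by (simp add: Set_cat_sel)
  with closed assoc left right show ?thesis
    unfolding is_category_def by (simp add: Set_cat_sel(1,3-6))
qed

section \<open>The input category and the functor encoding a language\<close>

datatype mobj = In | States | Out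

text \<open>\<open>Word w\<close> and \<open>WordBar w\<close> are the arrows from \<open>In\<close> to \<open>States\<close> and to \<open>Out\<close>; \<open>Ctx u v\<close>
  and \<open>CtxBar u v\<close> are the arrows from \<open>States\<close> to \<open>States\<close> and to \<open>Out\<close>. The identity of
  \<open>States\<close> is \<open>Ctx [] []\<close>.\<close>

datatype 'a marr =
    IdIn
  | IdOut
  | Word "'a list"
  | WordBar "'a list"
  | Ctx "'a list" "'a list"
  | CtxBar "'a list" "'a list"

fun mon_src :: "'a marr \<Rightarrow> mobj" where
  "mon_src IdIn = In"
| "mon_src IdOut = Out"
| "mon_src (Word w) = In"
| "mon_src (WordBar w) = In"
| "mon_src (Ctx u v) = States"
| "mon_src (CtxBar u v) = States"

fun mon_tgt :: "'a marr \<Rightarrow> mobj" where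
  "mon_tgt IdIn = In"
| "mon_tgt IdOut = Out"
| "mon_tgt (Word w) = States"
| "mon_tgt (WordBar w) = Out"
| "mon_tgt (Ctx u v) = States"
| "mon_tgt (CtxBar u v) = Out"

fun mon_ident :: "mobj \<Rightarrow> 'a marr" where
  "mon_ident In = IdIn"
| "mon_ident States = Ctx [] []"
| "mon_ident Out = IdOut"

fun mon_cmp :: "'a marr \<Rightarrow> 'a marr \<Rightarrow> 'a marr" where
  "mon_cmp g IdIn = g"
| "mon_cmp IdOut f = f"
| "mon_cmp (Ctx u v) (Word w) = Word (u @ w @ v)"
| "mon_cmp (Ctx u' v') (Ctx u v) = Ctx (u' @ u) (v @ v')"
| "mon_cmp (CtxBar u v) (Word w) = WordBar (u @ w @ v)"
| "mon_cmp (CtxBar u' v') (Ctx u v) = CtxBar (u' @ u) (v @ v')"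
| "mon_cmp g f = undefined"

definition I_Mon :: "'a set \<Rightarrow> (mobj, 'a marr) cat" where
  "I_Mon A =
     \<lparr>Ob = {In, States, Out},
      Ar = {IdIn, IdOut} \<union> Word ` lists A \<union> WordBar ` lists A
           \<union> case_prod Ctx ` (lists A \<times> lists A) \<union> case_prod CtxBar ` (lists A \<times> lists A),
      src = mon_src,
      tgt = mon_tgt,
      ident = mon_ident,
      cmp = mon_cmp\<rparr>"

lemma Ar_I_Mon:
  "IdIn \<in> Ar (I_Mon A)"
  "IdOut \<in> Ar (I_Mon A)"
  "Word w \<in> Ar (I_Mon A) \<longleftrightarrow> w \<in> lists A"
  "WordBar w \<in> Ar (I_Mon A) \<longleftrightarrow> w \<in> lists A"
  "Ctx u v \<in> Ar (I_Mon A) \<longleftrightarrow> u \<in> lists A \<and> v \<in> lists A"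
  "CtxBar u v \<in> Ar (I_Mon A) \<longleftrightarrow> u \<in> lists A \<and> v \<in> lists A"
  by (auto simp: I_Mon_def)

lemma I_Mon_sel:
  "Ob (I_Mon A) = {In, States, Out}"
  "src (I_Mon A) = mon_src"
  "tgt (I_Mon A) = mon_tgt"
  "ident (I_Mon A) = mon_ident"
  "cmp (I_Mon A) = mon_cmp"
  by (simp_all add: I_Mon_def)

lemma is_category_I_Mon: "is_category (I_Mon A)"
  unfolding is_category_def I_Mon_sel
proof (intro conjI ballI impI)
  fix f g :: "'a marr"
  assume fg: "f \<in> Ar (I_Mon A)" "g \<in> Ar (I_Mon A)" "mon_tgt f = mon_src g"
  show "mon_cmp g f \<in> Ar (I_Mon A)"
    using fg by (cases f; cases g) (simp_all add: Ar_I_Mon)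
  show "mon_src (mon_cmp g f) = mon_src f" "mon_tgt (mon_cmp g f) = mon_tgt g"
    using fg(3) by (cases f; cases g; simp)+
next
  fix f g h :: "'a marr"
  assume "mon_tgt f = mon_src g" "mon_tgt g = mon_src h"
  then show "mon_cmp h (mon_cmp g f) = mon_cmp (mon_cmp h g) f"
    by (cases f; cases g; cases h) simp_all
next
  fix f :: "'a marr" and X
  show "mon_src f \<in> {In, States, Out}" "mon_tgt f \<in> {In, States, Out}"
    "mon_cmp f (mon_ident (mon_src f)) = f" "mon_cmp (mon_ident (mon_tgt f)) f = f"
    by (cases f; simp)+
  show "mon_ident X \<in> Ar (I_Mon A)" "mon_src (mon_ident X) = X" "mon_tgt (mon_ident X) = X"
    by (cases X; simp add: Ar_I_Mon)+
qed

definition O_Mon :: "'a set \<Rightarrow> (mobj, 'a marr) cat" where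
  "O_Mon A = full_subcat (I_Mon A) {In, Out}"

definition incl :: "(mobj, 'a marr, mobj, 'a marr) func" where
  "incl = \<lparr>fob = id, far = id\<rparr>"

lemma is_functor_incl: "is_functor (O_Mon A) (I_Mon A) incl"
  unfolding is_functor_def O_Mon_def full_subcat_def incl_def I_Mon_def by auto

type_synonym ('a, 'u) set_func = "(mobj, 'a marr, 'u set, 'u sfun) func"

text \<open>The sets \<open>1 = {0}\<close> and \<open>2 = {0, 1}\<close>, for a universe with two distinguished distinct elements.\<close>

abbreviation one_set :: "'u::zero_neq_one set" where "one_set \<equiv> {0}"

abbreviation two_set :: "'u::zero_neq_one set" where "two_set \<equiv> {0, 1}"

definition lang_functor :: "'a list set \<Rightarrow> ('a, 'u::zero_neq_one) set_func" where
  "lang_functor L =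
     \<lparr>fob = (\<lambda>X. case X of In \<Rightarrow> one_set | Out \<Rightarrow> two_set | States \<Rightarrow> undefined),
      far = (\<lambda>f. case f of
               IdIn \<Rightarrow> ident Set_cat one_set
             | IdOut \<Rightarrow> ident Set_cat two_set
             | WordBar w \<Rightarrow> SFun one_set (\<lambda>x\<in>one_set. if w \<in> L then 1 else 0) two_set
             | _ \<Rightarrow> undefined)\<rparr>"

lemma is_functor_lang_functor: "is_functor (O_Mon A) Set_cat (lang_functor L)"
  unfolding is_functor_def O_Mon_def full_subcat_def lang_functor_def I_Mon_def Set_cat_def
  by (auto simp: compose_def restrict_def fun_eq_iff)

section \<open>Automata and the minimal automaton\<close>

definition is_automaton :: "'a set \<Rightarrow> ('a, 'u::zero_neq_one) set_func \<Rightarrow> bool" where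
  "is_automaton A F \<longleftrightarrow>
     is_functor (I_Mon A) Set_cat F \<and> fob F In = one_set \<and> fob F Out = two_set"

definition accepts ::
  "'a set \<Rightarrow> ('a, 'u::zero_neq_one) set_func \<Rightarrow> ('a, 'u) set_func \<Rightarrow> bool" where
  "accepts A F \<L> \<longleftrightarrow> is_automaton A F \<and> func_eq (O_Mon A) (func_comp F incl) \<L>"

definition is_aut_morphism ::
  "'a set \<Rightarrow> ('a, 'u::zero_neq_one) set_func \<Rightarrow> ('a, 'u) set_func \<Rightarrow> (mobj \<Rightarrow> 'u sfun) \<Rightarrow> bool"
  where
  "is_aut_morphism A F G \<eta> \<longleftrightarrow>
     is_nat_trans (I_Mon A) Set_cat F G \<eta> \<and>
     \<eta> In = ident Set_cat one_set \<and> \<eta> Out = ident Set_cat two_set"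

definition is_initial_automaton ::
  "'a set \<Rightarrow> ('a, 'u::zero_neq_one) set_func \<Rightarrow> ('a, 'u) set_func \<Rightarrow> bool" where
  "is_initial_automaton A \<L> I \<longleftrightarrow>
     accepts A I \<L> \<and> (\<forall>B. accepts A B \<L> \<longrightarrow> (\<exists>!\<eta>. is_aut_morphism A I B \<eta>))"

definition is_final_automaton ::
  "'a set \<Rightarrow> ('a, 'u::zero_neq_one) set_func \<Rightarrow> ('a, 'u) set_func \<Rightarrow> bool" where
  "is_final_automaton A \<L> F \<longleftrightarrow>
     accepts A F \<L> \<and> (\<forall>B. accepts A B \<L> \<longrightarrow> (\<exists>!\<eta>. is_aut_morphism A B F \<eta>))"

text \<open>\<open>M\<close> is a choice of \<open>Min(\<L>)\<close>; initial objects, final objects and factorizations are only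
  determined up to isomorphism, hence a predicate rather than a function.\<close>

definition is_Min ::
  "'a set \<Rightarrow> ('a, 'u::zero_neq_one) set_func \<Rightarrow> ('a, 'u) set_func \<Rightarrow> bool" where
  "is_Min A \<L> M \<longleftrightarrow>
     accepts A M \<L> \<and>
     (\<exists>I F h e m.
        is_initial_automaton A \<L> I \<and> is_final_automaton A \<L> F \<and>
        is_aut_morphism A I F h \<and> is_aut_morphism A I M e \<and> is_aut_morphism A M F m \<and>
        (\<forall>X\<in>Ob (I_Mon A). h X = cmp Set_cat (m X) (e X) \<and>
           sapp (e X) ` fob I X = fob M X \<and> inj_on (sapp (m X)) (fob M X)))"

section \<open>Biaction recognizers\<close>

record ('a, 'x) recognizer =
  rset :: "'x set"
  lact :: "'a list \<Rightarrow> 'x \<Rightarrow> 'x"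
  ract :: "'x \<Rightarrow> 'a list \<Rightarrow> 'x"
  rmap :: "'a list \<Rightarrow> 'x"
  racc :: "'x set"

definition is_biaction ::
  "'a set \<Rightarrow> 'x set \<Rightarrow> ('a list \<Rightarrow> 'x \<Rightarrow> 'x) \<Rightarrow> ('x \<Rightarrow> 'a list \<Rightarrow> 'x) \<Rightarrow> bool" where
  "is_biaction A X l r \<longleftrightarrow>
     (\<forall>u\<in>lists A. \<forall>x\<in>X. l u x \<in> X \<and> r x u \<in> X) \<and>
     (\<forall>x\<in>X. l [] x = x \<and> r x [] = x) \<and>
     (\<forall>u\<in>lists A. \<forall>v\<in>lists A. \<forall>x\<in>X.
        l (u @ v) x = l u (l v x) \<and> r x (u @ v) = r (r x u) v \<and> l u (r x v) = r (l u x) v)"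

definition is_biaction_morphism ::
  "'a set \<Rightarrow> 'x set \<Rightarrow> ('a list \<Rightarrow> 'x \<Rightarrow> 'x) \<Rightarrow> ('x \<Rightarrow> 'a list \<Rightarrow> 'x)
     \<Rightarrow> 'y set \<Rightarrow> ('a list \<Rightarrow> 'y \<Rightarrow> 'y) \<Rightarrow> ('y \<Rightarrow> 'a list \<Rightarrow> 'y) \<Rightarrow> ('x \<Rightarrow> 'y) \<Rightarrow> bool" where
  "is_biaction_morphism A X l r Y l' r' h \<longleftrightarrow>
     h \<in> X \<rightarrow> Y \<and>
     (\<forall>u\<in>lists A. \<forall>x\<in>X. h (l u x) = l' u (h x) \<and> h (r x u) = r' (h x) u)"

text \<open>The words over \<open>A\<close> act on themselves by concatenation on either side.\<close>

definition is_recognizer :: "'a set \<Rightarrow> ('a, 'x) recognizer \<Rightarrow> bool" where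
  "is_recognizer A R \<longleftrightarrow>
     is_biaction A (rset R) (lact R) (ract R) \<and>
     is_biaction_morphism A (lists A) (@) (@) (rset R) (lact R) (ract R) (rmap R) \<and>
     racc R \<subseteq> rset R"

definition is_recognizer_morphism ::
  "'a set \<Rightarrow> ('a, 'x) recognizer \<Rightarrow> ('a, 'y) recognizer \<Rightarrow> ('x \<Rightarrow> 'y) \<Rightarrow> bool" where
  "is_recognizer_morphism A R S h \<longleftrightarrow>
     is_biaction_morphism A (rset R) (lact R) (ract R) (rset S) (lact S) (ract S) h \<and>
     (\<forall>w\<in>lists A. h (rmap R w) = rmap S w) \<and>
     (\<forall>x\<in>rset R. x \<in> racc R \<longleftrightarrow> h x \<in> racc S)"

definition recognizer_iso ::
  "'a set \<Rightarrow> ('a, 'x) recognizer \<Rightarrow> ('a, 'y) recognizer \<Rightarrow> bool" where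
  "recognizer_iso A R S \<longleftrightarrow>
     is_recognizer A R \<and> is_recognizer A S \<and>
     (\<exists>h k. is_recognizer_morphism A R S h \<and> is_recognizer_morphism A S R k \<and>
        (\<forall>x\<in>rset R. k (h x) = x) \<and> (\<forall>y\<in>rset S. h (k y) = y))"

definition recognizer_of :: "('a, 'u::zero_neq_one) set_func \<Rightarrow> ('a, 'u) recognizer" where
  "recognizer_of F =
     \<lparr>rset = fob F States,
      lact = (\<lambda>u. sapp (far F (Ctx u []))),
      ract = (\<lambda>x v. sapp (far F (Ctx [] v)) x),
      rmap = (\<lambda>w. sapp (far F (Word w)) 0),
      racc = {x \<in> fob F States. sapp (far F (CtxBar [] [])) x = 1}\<rparr>"

section \<open>Monoid recognizers and the syntactic monoid\<close>

definition free_mon :: "'a set \<Rightarrow> 'a list monoid" where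
  "free_mon A = \<lparr>carrier = lists A, mult = (@), one = []\<rparr>"

definition is_monoid_recognizer ::
  "'a set \<Rightarrow> 'x monoid \<Rightarrow> ('a list \<Rightarrow> 'x) \<Rightarrow> 'x set \<Rightarrow> bool" where
  "is_monoid_recognizer A M \<phi> P \<longleftrightarrow>
     monoid M \<and> \<phi> \<in> hom (free_mon A) M \<and> \<phi> \<one>\<^bsub>free_mon A\<^esub> = \<one>\<^bsub>M\<^esub> \<and> P \<subseteq> carrier M"

definition underlying_recognizer ::
  "'x monoid \<Rightarrow> ('a list \<Rightarrow> 'x) \<Rightarrow> 'x set \<Rightarrow> ('a, 'x) recognizer" where
  "underlying_recognizer M \<phi> P =
     \<lparr>rset = carrier M,
      lact = (\<lambda>u m. \<phi> u \<otimes>\<^bsub>M\<^esub> m),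
      ract = (\<lambda>m v. m \<otimes>\<^bsub>M\<^esub> \<phi> v),
      rmap = \<phi>,
      racc = P\<rparr>"

definition syn_cong :: "'a set \<Rightarrow> 'a list set \<Rightarrow> ('a list \<times> 'a list) set" where
  "syn_cong A L =
     {(w, w'). w \<in> lists A \<and> w' \<in> lists A \<and>
        (\<forall>u\<in>lists A. \<forall>v\<in>lists A. u @ w @ v \<in> L \<longleftrightarrow> u @ w' @ v \<in> L)}"

definition syn_class :: "'a set \<Rightarrow> 'a list set \<Rightarrow> 'a list \<Rightarrow> 'a list set" where
  "syn_class A L w = syn_cong A L `` {w}"

text \<open>The product of two classes is the class of \<open>x @ y\<close> for any representatives \<open>x\<close>, \<open>y\<close>; the
  union is the usual lifting of a congruence-respecting operation to equivalence classes.\<close>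

definition Syn :: "'a set \<Rightarrow> 'a list set \<Rightarrow> 'a list set monoid" where
  "Syn A L =
     \<lparr>carrier = lists A // syn_cong A L,
      mult = (\<lambda>X Y. \<Union>x\<in>X. \<Union>y\<in>Y. syn_class A L (x @ y)),
      one = syn_class A L []\<rparr>"

section \<open>Large universes\<close>

text \<open>The category of sets over \<open>'u\<close> stands for the category of all sets only if \<open>'u\<close> has room for
  the automata at hand, the largest being the final automaton, whose states are the sets of pairs
  of words.\<close>

definition large_universe :: "'a set \<Rightarrow> 'u itself \<Rightarrow> bool" where
  "large_universe A _ \<longleftrightarrow>
     (\<exists>f :: ('a list \<times> 'a list) set \<Rightarrow> 'u. inj_on f (Pow (lists A \<times> lists A)))"

text \<open>Such universes exist for every alphabet.\<close>

datatype 'b pointed = Pt_zero | Pt_one | Pt 'b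

instantiation pointed :: (type) zero_neq_one
begin

definition "0 = Pt_zero"

definition "1 = Pt_one"

instance by standard (simp add: zero_pointed_def one_pointed_def)

end

lemma large_universe_pointed: "large_universe A TYPE(('a list \<times> 'a list) set pointed)"
  for A :: "'a set"
  unfolding large_universe_def by (intro exI[of _ Pt]) (simp add: inj_on_def)

end

theory Submission
  imports Defs
begin

text \<open>The states of the initial automaton are the words, and those of the final automaton are the sets
  of contexts. Comparing an arbitrary initial (final) automaton with these shows that in \<open>Min(\<L>)\<close>
  every state is reached by a word, and that two states accepted in the same contexts are equal.
  Hence two words reach the same state of \<open>Min(\<L>)\<close> iff they are syntactically congruent, and
  sending the class of a word to the state that it reaches is the required isomorphism.\<close>

section \<open>Automata through their states\<close>

text \<open>Otherwise \<open>auto\<close> replaces \<open>w \<in> lists A\<close> by \<open>\<forall>x\<in>set w. x \<in> A\<close>, and the lemmas about words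
  no longer apply.\<close>

declare in_listsD [rule del] in_listsI [rule del]

text \<open>Initiality and finality speak only of automata whose states lie in \<open>'u\<close>, so
  the models must be built inside that type; every construction is transported along the injection
  supplied by \<open>large_universe\<close>. The models are the two Kan extensions along the
  inclusion: a word is an arrow from \<open>In\<close> to \<open>States\<close>, and a set of
  contexts is a function into \<open>two_set\<close> on the arrows from \<open>States\<close> to
  \<open>Out\<close>. The comparison is a retract argument: passing from a given initial (final)
  automaton to the model and back is an endomorphism, hence the identity, so reachability
  (separation) carries over from the model. The link with the monoid is that words \<open>w\<close>
  and \<open>w'\<close> over \<open>A\<close> are congruent exactly when
  \<open>contexts A L w\<close> and \<open>contexts A L w'\<close> agree.\<close>

definition st :: "('a, 'u::zero_neq_one) set_func \<Rightarrow> 'a list \<Rightarrow> 'u" where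
  "st F w = sapp (far F (Word w)) 0"

definition ct :: "('a, 'u) set_func \<Rightarrow> 'a list \<Rightarrow> 'a list \<Rightarrow> 'u \<Rightarrow> 'u" where
  "ct F u v x = sapp (far F (Ctx u v)) x"

text \<open>The arrows \<open>WordBar w\<close> get no such reading, since acceptance already fixes
  their values.\<close>

definition ob :: "('a, 'u) set_func \<Rightarrow> 'a list \<Rightarrow> 'a list \<Rightarrow> 'u \<Rightarrow> 'u" where
  "ob F u v x = sapp (far F (CtxBar u v)) x"

lemma automaton_arrow:
  assumes "is_automaton A F" "f \<in> Ar (I_Mon A)"
  shows "sdom (far F f) = fob F (mon_src f)" "scod (far F f) = fob F (mon_tgt f)"
    "sapp (far F f) \<in> fob F (mon_src f) \<rightarrow>\<^sub>E fob F (mon_tgt f)"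
proof -
  have "far F f \<in> Ar Set_cat"
    "sdom (far F f) = fob F (mon_src f)" "scod (far F f) = fob F (mon_tgt f)"
    using assms by (simp_all add: is_automaton_def is_functor_def I_Mon_sel Set_cat_sel(3,4))
  then show "sapp (far F f) \<in> fob F (mon_src f) \<rightarrow>\<^sub>E fob F (mon_tgt f)"
    by (simp add: Set_cat_sel)
qed (use assms in \<open>simp_all add: is_automaton_def is_functor_def I_Mon_sel Set_cat_sel(3,4)\<close>)

lemma automaton_comp:
  assumes "is_automaton A F" "f \<in> Ar (I_Mon A)" "g \<in> Ar (I_Mon A)" "mon_tgt f = mon_src g"
    and "x \<in> fob F (mon_src f)"
  shows "sapp (far F (mon_cmp g f)) x = sapp (far F g) (sapp (far F f) x)"
proof -
  have "far F (mon_cmp g f) = cmp Set_cat (far F g) (far F f)"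
    using assms(1-4) unfolding is_automaton_def is_functor_def by (simp add: I_Mon_sel)
  then show ?thesis
    using automaton_arrow[OF assms(1,2)] assms(5) by (simp add: Set_cat_sel compose_def)
qed

lemma automaton_ident:
  assumes "is_automaton A F"
  shows "far F IdIn = ident Set_cat one_set" "far F IdOut = ident Set_cat two_set"
    "far F (Ctx [] []) = ident Set_cat (fob F States)"
proof -
  have "far F (mon_ident X) = ident Set_cat (fob F X)" for X
    using assms unfolding is_automaton_def is_functor_def by (cases X) (simp_all add: I_Mon_sel)
  from this[of In] this[of Out] this[of States]
  show "far F IdIn = ident Set_cat one_set" "far F IdOut = ident Set_cat two_set"
    "far F (Ctx [] []) = ident Set_cat (fob F States)"
    using assms by (simp_all add: is_automaton_def)
qed

lemma accepts_is_automaton: "accepts A F \<L> \<Longrightarrow> is_automaton A F"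
  by (simp add: accepts_def)

text \<open>Apart from identities, \<open>O_Mon A\<close> has only these arrows, so this is the
  whole content of acceptance.\<close>

lemma accepts_WordBar:
  assumes "accepts A F (lang_functor L)" "w \<in> lists A"
  shows "far F (WordBar w) = SFun one_set (\<lambda>x\<in>one_set. if w \<in> L then 1 else 0) two_set"
proof -
  have "WordBar w \<in> Ar (O_Mon A)"
    using assms(2) by (simp add: O_Mon_def full_subcat_def Ar_I_Mon I_Mon_sel)
  then show ?thesis
    using assms(1) unfolding accepts_def func_eq_def
    by (auto simp: func_comp_def incl_def lang_functor_def)
qed

section \<open>Functoriality as equations between states\<close>

context
  fixes A :: "'a set" and F :: "('a, 'u::zero_neq_one) set_func" and L
  assumes acc: "accepts A F (lang_functor L)"
begin

private lemmas aut = accepts_is_automaton[OF acc]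

private lemma obj: "fob F In = one_set" "fob F Out = two_set"
  using aut by (simp_all add: is_automaton_def)

lemma st_closed: "w \<in> lists A \<Longrightarrow> st F w \<in> fob F States"
  using automaton_arrow(3)[OF aut, of "Word w"]
  by (auto simp: Ar_I_Mon st_def obj PiE_iff)

lemma ct_closed:
  "u \<in> lists A \<Longrightarrow> v \<in> lists A \<Longrightarrow> x \<in> fob F States \<Longrightarrow> ct F u v x \<in> fob F States"
  using automaton_arrow(3)[OF aut, of "Ctx u v"]
  by (auto simp: Ar_I_Mon ct_def PiE_iff)

lemma ob_range:
  "u \<in> lists A \<Longrightarrow> v \<in> lists A \<Longrightarrow> x \<in> fob F States \<Longrightarrow> ob F u v x = 0 \<or> ob F u v x = 1"
  using automaton_arrow(3)[OF aut, of "CtxBar u v"]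
  by (auto simp: Ar_I_Mon ob_def obj PiE_iff)

lemma ct_Nil: "x \<in> fob F States \<Longrightarrow> ct F [] [] x = x"
  by (simp add: ct_def automaton_ident[OF aut] Set_cat_sel)

lemma ct_ct:
  assumes "u \<in> lists A" "v \<in> lists A" "u' \<in> lists A" "v' \<in> lists A" "x \<in> fob F States"
  shows "ct F u' v' (ct F u v x) = ct F (u' @ u) (v @ v') x"
  using automaton_comp[OF aut, of "Ctx u v" "Ctx u' v'" x] assms by (simp add: Ar_I_Mon ct_def)

lemma ct_st:
  assumes "u \<in> lists A" "v \<in> lists A" "w \<in> lists A"
  shows "ct F u v (st F w) = st F (u @ w @ v)"
  using automaton_comp[OF aut, of "Word w" "Ctx u v" 0] assms
  by (simp add: Ar_I_Mon ct_def st_def obj)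

lemma ob_ct:
  assumes "u \<in> lists A" "v \<in> lists A" "u' \<in> lists A" "v' \<in> lists A" "x \<in> fob F States"
  shows "ob F u' v' (ct F u v x) = ob F (u' @ u) (v @ v') x"
  using automaton_comp[OF aut, of "Ctx u v" "CtxBar u' v'" x] assms
  by (simp add: Ar_I_Mon ct_def ob_def)

text \<open>This is where the language enters: \<open>CtxBar u v\<close> after \<open>Word w\<close>
  is \<open>WordBar (u @ w @ v)\<close>, whose value acceptance prescribes.\<close>

lemma ob_st:
  assumes "u \<in> lists A" "v \<in> lists A" "w \<in> lists A"
  shows "ob F u v (st F w) = (if u @ w @ v \<in> L then 1 else 0)"
  using automaton_comp[OF aut, of "Word w" "CtxBar u v" 0] assms
    accepts_WordBar[OF acc, of "u @ w @ v"]
  by (simp add: Ar_I_Mon ob_def st_def obj)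

end

section \<open>Morphisms through their component at the states\<close>

text \<open>The function is taken extensional so that it corresponds to exactly one morphism and
  \<open>\<exists>!\<close> can be transferred.\<close>

definition aut_map ::
  "'a set \<Rightarrow> ('a, 'u::zero_neq_one) set_func \<Rightarrow> ('a, 'u) set_func \<Rightarrow> ('u \<Rightarrow> 'u) \<Rightarrow> bool" where
  "aut_map A F G h \<longleftrightarrow>
     h \<in> fob F States \<rightarrow>\<^sub>E fob G States \<and>
     (\<forall>w\<in>lists A. h (st F w) = st G w) \<and>
     (\<forall>u\<in>lists A. \<forall>v\<in>lists A. \<forall>x\<in>fob F States.
        h (ct F u v x) = ct G u v (h x) \<and> ob F u v x = ob G u v (h x))"

lemma aut_mapI:
  assumes "h \<in> fob F States \<rightarrow>\<^sub>E fob G States"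
    and "\<And>w. w \<in> lists A \<Longrightarrow> h (st F w) = st G w"
    and "\<And>u v x. u \<in> lists A \<Longrightarrow> v \<in> lists A \<Longrightarrow> x \<in> fob F States \<Longrightarrow> h (ct F u v x) = ct G u v (h x)"
    and "\<And>u v x. u \<in> lists A \<Longrightarrow> v \<in> lists A \<Longrightarrow> x \<in> fob F States \<Longrightarrow> ob F u v x = ob G u v (h x)"
  shows "aut_map A F G h"
  using assms by (simp add: aut_map_def)

lemma aut_mapD:
  assumes "aut_map A F G h"
  shows "h \<in> fob F States \<rightarrow>\<^sub>E fob G States"
    and "x \<in> fob F States \<Longrightarrow> h x \<in> fob G States"
    and "w \<in> lists A \<Longrightarrow> h (st F w) = st G w"
    and "u \<in> lists A \<Longrightarrow> v \<in> lists A \<Longrightarrow> x \<in> fob F States \<Longrightarrow> h (ct F u v x) = ct G u v (h x)"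
    and "u \<in> lists A \<Longrightarrow> v \<in> lists A \<Longrightarrow> x \<in> fob F States \<Longrightarrow> ob F u v x = ob G u v (h x)"
  using assms by (auto simp: aut_map_def)

definition aut_mor ::
  "('a, 'u::zero_neq_one) set_func \<Rightarrow> ('a, 'u) set_func \<Rightarrow> ('u \<Rightarrow> 'u) \<Rightarrow> mobj \<Rightarrow> 'u sfun" where
  "aut_mor F G h X = (case X of In \<Rightarrow> ident Set_cat one_set | Out \<Rightarrow> ident Set_cat two_set
     | States \<Rightarrow> SFun (fob F States) h (fob G States))"

lemma aut_mor_sel [simp]:
  "aut_mor F G h In = ident Set_cat one_set"
  "aut_mor F G h Out = ident Set_cat two_set"
  "aut_mor F G h States = SFun (fob F States) h (fob G States)"
  by (simp_all add: aut_mor_def)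

lemma is_aut_morphism_aut_mor:
  assumes accF: "accepts A F (lang_functor L)" and accG: "accepts A G (lang_functor L)"
    and h: "aut_map A F G h"
  shows "is_aut_morphism A F G (aut_mor F G h)"
  unfolding is_aut_morphism_def is_nat_trans_def I_Mon_sel
proof (intro conjI ballI)
  note autF = accepts_is_automaton[OF accF] and autG = accepts_is_automaton[OF accG]
  have obj: "fob F In = one_set" "fob F Out = two_set" "fob G In = one_set" "fob G Out = two_set"
    using autF autG by (simp_all add: is_automaton_def)
  fix X assume "X \<in> {In, States, Out}"
  then show "aut_mor F G h X \<in> Ar Set_cat" "src Set_cat (aut_mor F G h X) = fob F X"
    "tgt Set_cat (aut_mor F G h X) = fob G X"
    using aut_mapD(1)[OF h] by (auto simp: obj Set_cat_sel)
next
  note autF = accepts_is_automaton[OF accF] and autG = accepts_is_automaton[OF accG]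
  have obj: "fob F In = one_set" "fob F Out = two_set" "fob G In = one_set" "fob G Out = two_set"
    using autF autG by (simp_all add: is_automaton_def)
  fix f assume f: "f \<in> Ar (I_Mon A)"
  note F = automaton_arrow[OF autF f] and G = automaton_arrow[OF autG f]
  show "cmp Set_cat (far G f) (aut_mor F G h (mon_src f)) =
      cmp Set_cat (aut_mor F G h (mon_tgt f)) (far F f)"
  proof (cases f)
    case IdIn
    then show ?thesis by (simp add: automaton_ident[OF autF] automaton_ident[OF autG])
  next
    case IdOut
    then show ?thesis by (simp add: automaton_ident[OF autF] automaton_ident[OF autG])
  next
    case (Word w)
    then show ?thesis using F G f aut_mapD(3)[OF h, of w]
      by (auto simp: Set_cat_sel obj compose_def Ar_I_Mon st_def fun_eq_iff)
  next
    \<comment> \<open>This square puts no condition on \<open>h\<close>: both functors accept the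
      same language and agree on this arrow.\<close>
    case (WordBar w)
    then show ?thesis using f
      by (simp add: accepts_WordBar[OF accF] accepts_WordBar[OF accG] Set_cat_sel compose_def
          Ar_I_Mon fun_eq_iff)
  next
    case (Ctx u v)
    then show ?thesis using F G f aut_mapD(4)[OF h, of u v]
      by (auto simp: Set_cat_sel compose_def Ar_I_Mon ct_def fun_eq_iff)
  next
    case (CtxBar u v)
    then show ?thesis using F G f aut_mapD(5)[OF h, of u v]
      by (force simp: Set_cat_sel obj compose_def Ar_I_Mon ob_def fun_eq_iff)
  qed
qed simp_all

lemma aut_morphism_imp_aut_map:
  assumes accF: "accepts A F (lang_functor L)" and accG: "accepts A G (lang_functor L)"
    and \<eta>: "is_aut_morphism A F G \<eta>"
  shows "aut_map A F G (sapp (\<eta> States))" "\<eta> = aut_mor F G (sapp (\<eta> States))"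
proof -
  note autF = accepts_is_automaton[OF accF] and autG = accepts_is_automaton[OF accG]
  have obj: "fob F In = one_set" "fob F Out = two_set" "fob G In = one_set" "fob G Out = two_set"
    using autF autG by (simp_all add: is_automaton_def)
  have io: "\<eta> In = ident Set_cat one_set" "\<eta> Out = ident Set_cat two_set"
    using \<eta> by (simp_all add: is_aut_morphism_def)
  have s: "\<eta> States \<in> Ar Set_cat" "sdom (\<eta> States) = fob F States" "scod (\<eta> States) = fob G States"
    using \<eta> by (simp_all add: is_aut_morphism_def is_nat_trans_def I_Mon_sel Set_cat_sel(3,4))
  have nat: "sapp (far G f) (sapp (\<eta> (mon_src f)) x) = sapp (\<eta> (mon_tgt f)) (sapp (far F f) x)"
    if f: "f \<in> Ar (I_Mon A)" and x: "x \<in> fob F (mon_src f)" for f x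
  proof -
    have "cmp Set_cat (far G f) (\<eta> (mon_src f)) = cmp Set_cat (\<eta> (mon_tgt f)) (far F f)"
      using \<eta> f by (simp add: is_aut_morphism_def is_nat_trans_def I_Mon_sel)
    moreover have "sdom (\<eta> (mon_src f)) = fob F (mon_src f)"
      by (cases "mon_src f") (simp_all add: s io obj Set_cat_sel)
    moreover have "sdom (far F f) = fob F (mon_src f)"
      using automaton_arrow[OF autF f] by simp
    ultimately show ?thesis
      using x by (auto simp: Set_cat_sel compose_def fun_eq_iff split: if_splits)
  qed
  have range: "sapp (\<eta> States) \<in> fob F States \<rightarrow>\<^sub>E fob G States"
    using s by (simp add: Set_cat_sel)
  show "aut_map A F G (sapp (\<eta> States))"
  proof (rule aut_mapI[OF range])
    show "sapp (\<eta> States) (st F w) = st G w" if "w \<in> lists A" for w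
      using nat[of "Word w" 0] that by (simp add: Ar_I_Mon obj io Set_cat_sel st_def)
  next
    fix u v x assume uvx: "u \<in> lists A" "v \<in> lists A" "x \<in> fob F States"
    then show "sapp (\<eta> States) (ct F u v x) = ct G u v (sapp (\<eta> States) x)"
      using nat[of "Ctx u v" x] by (simp add: Ar_I_Mon ct_def)
    \<comment> \<open>The identity at \<open>Out\<close> is a function restricted to
      \<open>two_set\<close>, so it fixes the observation only once this is known.\<close>
    have "ob F u v x \<in> two_set"
      using ob_range[OF accF uvx] by auto
    then show "ob F u v x = ob G u v (sapp (\<eta> States) x)"
      using nat[of "CtxBar u v" x] uvx by (simp add: Ar_I_Mon ob_def io Set_cat_sel)
  qed
  show "\<eta> = aut_mor F G (sapp (\<eta> States))"
  proof
    fix X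
    show "\<eta> X = aut_mor F G (sapp (\<eta> States)) X"
      using s by (cases X) (simp_all add: io sfun.expand)
  qed
qed

text \<open>Initiality and finality are phrased by unique existence; this moves them to maps of
  states.\<close>

lemma ex1_aut_morphism_iff:
  assumes "accepts A F (lang_functor L)" "accepts A G (lang_functor L)"
  shows "(\<exists>!\<eta>. is_aut_morphism A F G \<eta>) \<longleftrightarrow> (\<exists>!h. aut_map A F G h)"
proof
  assume ex: "\<exists>!\<eta>. is_aut_morphism A F G \<eta>"
  then obtain \<eta> where \<eta>: "is_aut_morphism A F G \<eta>"
    by blast
  have "h = sapp (\<eta> States)" if "aut_map A F G h" for h
  proof -
    have "aut_mor F G h = \<eta>"
      using ex \<eta> is_aut_morphism_aut_mor[OF assms that] by blast
    then show ?thesis by (auto simp flip: \<open>aut_mor F G h = \<eta>\<close>)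
  qed
  with aut_morphism_imp_aut_map(1)[OF assms \<eta>] show "\<exists>!h. aut_map A F G h"
    by blast
next
  assume "\<exists>!h. aut_map A F G h"
  then show "\<exists>!\<eta>. is_aut_morphism A F G \<eta>"
    using is_aut_morphism_aut_mor[OF assms] aut_morphism_imp_aut_map[OF assms] by metis
qed

lemma is_initial_automaton_iff:
  "is_initial_automaton A (lang_functor L) I \<longleftrightarrow>
     accepts A I (lang_functor L) \<and>
     (\<forall>B. accepts A B (lang_functor L) \<longrightarrow> (\<exists>!h. aut_map A I B h))"
  unfolding is_initial_automaton_def
  by (intro conj_cong refl all_cong1 imp_cong ex1_aut_morphism_iff)

lemma is_final_automaton_iff:
  "is_final_automaton A (lang_functor L) F \<longleftrightarrow>
     accepts A F (lang_functor L) \<and>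
     (\<forall>B. accepts A B (lang_functor L) \<longrightarrow> (\<exists>!h. aut_map A B F h))"
  unfolding is_final_automaton_def
  by (intro conj_cong refl all_cong1 imp_cong ex1_aut_morphism_iff)

lemma aut_map_id:
  assumes "accepts A F (lang_functor L)"
  shows "aut_map A F F (\<lambda>x\<in>fob F States. x)"
  by (rule aut_mapI) (simp_all add: st_closed[OF assms] ct_closed[OF assms])

lemma aut_map_compose:
  assumes "accepts A F (lang_functor L)" "aut_map A F G h" "aut_map A G H k"
  shows "aut_map A F H (compose (fob F States) k h)"
proof (rule aut_mapI)
  show "compose (fob F States) k h \<in> fob F States \<rightarrow>\<^sub>E fob H States"
    using aut_mapD(2)[OF assms(2)] aut_mapD(2)[OF assms(3)] by (auto simp: compose_def)
qed (simp_all add: compose_def st_closed[OF assms(1)] ct_closed[OF assms(1)]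
    aut_mapD(2-)[OF assms(2)] aut_mapD(2-)[OF assms(3)])

section \<open>The automaton of words and the automaton of sets of contexts\<close>

text \<open>The common form of the initial, the final and the minimal automaton. Arrows from
  \<open>States\<close> to \<open>Out\<close> act first and then test membership in
  \<open>P\<close>, which reduces their functoriality to that of the action.\<close>

definition mk_aut ::
  "'u set \<Rightarrow> ('a list \<Rightarrow> 'u) \<Rightarrow> ('a list \<Rightarrow> 'a list \<Rightarrow> 'u \<Rightarrow> 'u) \<Rightarrow> 'u set
     \<Rightarrow> ('a, 'u::zero_neq_one) set_func" where
  "mk_aut S \<phi> act P =
     \<lparr>fob = (\<lambda>X. case X of In \<Rightarrow> one_set | Out \<Rightarrow> two_set | States \<Rightarrow> S),
      far = (\<lambda>f. case f of
               IdIn \<Rightarrow> ident Set_cat one_set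
             | IdOut \<Rightarrow> ident Set_cat two_set
             | Word w \<Rightarrow> SFun one_set (\<lambda>x\<in>one_set. \<phi> w) S
             | WordBar w \<Rightarrow> SFun one_set (\<lambda>x\<in>one_set. if \<phi> w \<in> P then 1 else 0) two_set
             | Ctx u v \<Rightarrow> SFun S (\<lambda>x\<in>S. act u v x) S
             | CtxBar u v \<Rightarrow> SFun S (\<lambda>x\<in>S. if act u v x \<in> P then 1 else 0) two_set)\<rparr>"

lemma mk_aut_sel:
  "fob (mk_aut S \<phi> act P) States = S"
  "st (mk_aut S \<phi> act P) w = \<phi> w"
  "x \<in> S \<Longrightarrow> ct (mk_aut S \<phi> act P) u v x = act u v x"
  "x \<in> S \<Longrightarrow> ob (mk_aut S \<phi> act P) u v x = (if act u v x \<in> P then 1 else 0)"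
  by (simp_all add: mk_aut_def st_def ct_def ob_def)

text \<open>Here \<open>act u v x\<close> stands for \<open>x\<close> acted on by \<open>u\<close>
  from the left and \<open>v\<close> from the right, so \<open>act_act\<close> contains both action
  laws and their commutation.\<close>

lemma accepts_mk_aut:
  fixes \<phi> :: "'a list \<Rightarrow> 'u::zero_neq_one"
  assumes S: "\<And>w. w \<in> lists A \<Longrightarrow> \<phi> w \<in> S"
    and act: "\<And>u v x. u \<in> lists A \<Longrightarrow> v \<in> lists A \<Longrightarrow> x \<in> S \<Longrightarrow> act u v x \<in> S"
    and act_Nil: "\<And>x. x \<in> S \<Longrightarrow> act [] [] x = x"
    and act_act: "\<And>u v u' v' x. u \<in> lists A \<Longrightarrow> v \<in> lists A \<Longrightarrow> u' \<in> lists A \<Longrightarrow> v' \<in> lists A \<Longrightarrow>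
      x \<in> S \<Longrightarrow> act u' v' (act u v x) = act (u' @ u) (v @ v') x"
    and act_\<phi>: "\<And>u v w. u \<in> lists A \<Longrightarrow> v \<in> lists A \<Longrightarrow> w \<in> lists A \<Longrightarrow>
      act u v (\<phi> w) = \<phi> (u @ w @ v)"
    and P: "\<And>w. w \<in> lists A \<Longrightarrow> \<phi> w \<in> P \<longleftrightarrow> w \<in> L"
  shows "accepts A (mk_aut S \<phi> act P) (lang_functor L)"
proof -
  let ?F = "mk_aut S \<phi> act P"
  have "is_functor (I_Mon A) Set_cat ?F"
    unfolding is_functor_def I_Mon_sel
  proof (intro conjI ballI impI)
    fix X
    show "fob ?F X \<in> Ob Set_cat" by (simp add: Set_cat_sel)
    show "far ?F (mon_ident X) = ident Set_cat (fob ?F X)"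
      by (cases X) (auto simp: mk_aut_def Set_cat_sel act_Nil restrict_def fun_eq_iff)
  next
    fix f assume f: "f \<in> Ar (I_Mon A)"
    show "far ?F f \<in> Ar Set_cat"
      using f by (cases f) (auto simp: mk_aut_def Set_cat_sel Ar_I_Mon S act)
    show "src Set_cat (far ?F f) = fob ?F (mon_src f)"
      "tgt Set_cat (far ?F f) = fob ?F (mon_tgt f)"
      by (cases f; simp add: mk_aut_def Set_cat_sel)+
  next
    fix f g assume "f \<in> Ar (I_Mon A)" "g \<in> Ar (I_Mon A)" "mon_tgt f = mon_src g"
    then show "far ?F (mon_cmp g f) = cmp Set_cat (far ?F g) (far ?F f)"
      by (cases f; cases g)
        (simp_all add: mk_aut_def Set_cat_sel Ar_I_Mon compose_def restrict_def fun_eq_iff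
          S act act_act act_\<phi>)
  qed
  then show ?thesis
    unfolding accepts_def is_automaton_def func_eq_def
    by (auto simp: func_comp_def incl_def O_Mon_def full_subcat_def I_Mon_def mk_aut_def
        lang_functor_def P)
qed

section \<open>The initial automaton\<close>

definition words_aut :: "'a set \<Rightarrow> 'a list set \<Rightarrow> ('a list \<Rightarrow> 'u) \<Rightarrow> ('a, 'u::zero_neq_one) set_func" where
  "words_aut A L i =
     mk_aut (i ` lists A) i (\<lambda>u v x. i (u @ inv_into (lists A) i x @ v)) (i ` (L \<inter> lists A))"

lemma accepts_words_aut:
  fixes i :: "'a list \<Rightarrow> 'u::zero_neq_one"
  assumes "inj_on i (lists A)"
  shows "accepts A (words_aut A L i) (lang_functor L)"
  unfolding words_aut_def
  by (rule accepts_mk_aut)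
    (auto simp: inv_into_f_f[OF assms] inj_on_image_mem_iff[OF assms])

text \<open>Each state is \<open>i w\<close> for exactly one word \<open>w\<close> over
  \<open>A\<close>, so the condition on words dictates the map; the conditions on contexts then
  reduce to \<open>ct_st\<close> and \<open>ob_st\<close> in source and target.\<close>

lemma is_initial_words_aut:
  fixes i :: "'a list \<Rightarrow> 'u::zero_neq_one"
  assumes "inj_on i (lists A)"
  shows "is_initial_automaton A (lang_functor L) (words_aut A L i)"
  unfolding is_initial_automaton_iff
proof (intro conjI allI impI accepts_words_aut[OF assms])
  let ?I = "words_aut A L i" and ?j = "inv_into (lists A) i"
  note acc = accepts_words_aut[OF assms, of L]
  have S: "fob ?I States = i ` lists A" and st: "\<And>w. st ?I w = i w"
    by (simp_all add: words_aut_def mk_aut_sel)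
  fix B :: "('a, 'u) set_func" assume B: "accepts A B (lang_functor L)"
  let ?h = "\<lambda>x\<in>i ` lists A. st B (?j x)"
  show "\<exists>!h. aut_map A ?I B h"
  proof (rule ex1I)
    show "aut_map A ?I B ?h"
    proof (rule aut_mapI, unfold S)
      show "?h \<in> i ` lists A \<rightarrow>\<^sub>E fob B States"
        by (auto simp only: restrict_PiE_iff inv_into_f_f[OF assms] intro: st_closed[OF B])
    next
      fix w assume "w \<in> lists A"
      then show "?h (st ?I w) = st B w"
        by (simp add: st inv_into_f_f[OF assms])
    next
      fix u v x assume uv: "u \<in> lists A" "v \<in> lists A" and "x \<in> i ` lists A"
      then obtain w where w: "w \<in> lists A" "x = st ?I w"
        by (auto simp only: st)
      have uwv: "u @ w @ v \<in> lists A" using uv w by simp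
      have h: "?h (st ?I w) = st B w" if "w \<in> lists A" for w
        using that by (simp add: st inv_into_f_f[OF assms])
      show "?h (ct ?I u v x) = ct B u v (?h x)"
        by (simp only: w(2) ct_st[OF acc uv w(1)] ct_st[OF B uv w(1)] h w(1) uwv)
      show "ob ?I u v x = ob B u v (?h x)"
        by (simp only: w(2) ob_st[OF acc uv w(1)] ob_st[OF B uv w(1)] h w(1))
    qed
  next
    fix h assume h: "aut_map A ?I B h"
    show "h = ?h"
    proof (rule PiE_ext)
      show "h \<in> i ` lists A \<rightarrow>\<^sub>E fob B States"
        using aut_mapD(1)[OF h] by (simp only: S)
      show "?h \<in> i ` lists A \<rightarrow>\<^sub>E fob B States"
        by (auto simp only: restrict_PiE_iff inv_into_f_f[OF assms] intro: st_closed[OF B])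
      show "h x = ?h x" if "x \<in> i ` lists A" for x
        using that aut_mapD(3)[OF h]
        by (auto simp: st inv_into_f_f[OF assms])
    qed
  qed
qed

section \<open>Sets of contexts and the final automaton\<close>

definition contexts :: "'a set \<Rightarrow> 'a list set \<Rightarrow> 'a list \<Rightarrow> ('a list \<times> 'a list) set" where
  "contexts A L w = {(u, v). u \<in> lists A \<and> v \<in> lists A \<and> u @ w @ v \<in> L}"

text \<open>If \<open>C\<close> collects the contexts accepting a state, this collects those
  accepting the state after \<open>(u, v)\<close> has acted on it. Only words over \<open>A\<close>
  are kept, so the result stays in the domain where the coding is injective.\<close>

definition contexts_act ::
  "'a set \<Rightarrow> 'a list \<Rightarrow> 'a list \<Rightarrow> ('a list \<times> 'a list) set \<Rightarrow> ('a list \<times> 'a list) set" where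
  "contexts_act A u v C = {(u', v'). u' \<in> lists A \<and> v' \<in> lists A \<and> (u' @ u, v @ v') \<in> C}"

lemma contexts_in: "contexts A L w \<in> Pow (lists A \<times> lists A)"
  by (auto simp: contexts_def)

lemma contexts_act_in: "contexts_act A u v C \<in> Pow (lists A \<times> lists A)"
  by (auto simp: contexts_act_def)

lemma contexts_act_contexts:
  "u \<in> lists A \<Longrightarrow> v \<in> lists A \<Longrightarrow> contexts_act A u v (contexts A L w) = contexts A L (u @ w @ v)"
  by (auto simp: contexts_act_def contexts_def)

text \<open>\<open>S\<close> is the set of all \<open>f C\<close> for the final automaton, and the set of the \<open>f (contexts A L w)\<close>
  for the minimal one.\<close>

definition contexts_aut ::
  "'a set \<Rightarrow> 'a list set \<Rightarrow> (('a list \<times> 'a list) set \<Rightarrow> 'u) \<Rightarrow> 'u set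
     \<Rightarrow> ('a, 'u::zero_neq_one) set_func" where
  "contexts_aut A L f S =
     mk_aut S (\<lambda>w. f (contexts A L w))
       (\<lambda>u v x. f (contexts_act A u v (inv_into (Pow (lists A \<times> lists A)) f x)))
       (f ` {C \<in> Pow (lists A \<times> lists A). ([], []) \<in> C})"

context
  fixes A :: "'a set" and L :: "'a list set" and f :: "('a list \<times> 'a list) set \<Rightarrow> 'u::zero_neq_one"
  assumes inj: "inj_on f (Pow (lists A \<times> lists A))"
begin

private abbreviation "all_ctxs \<equiv> Pow (lists A \<times> lists A)"

private lemma inv: "C \<in> all_ctxs \<Longrightarrow> inv_into all_ctxs f (f C) = C"
  using inj by (rule inv_into_f_f)

lemma accepts_contexts_aut:
  assumes "S \<subseteq> f ` all_ctxs"
    and "\<And>w. w \<in> lists A \<Longrightarrow> f (contexts A L w) \<in> S"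
    and "\<And>u v x. u \<in> lists A \<Longrightarrow> v \<in> lists A \<Longrightarrow> x \<in> S \<Longrightarrow>
      f (contexts_act A u v (inv_into all_ctxs f x)) \<in> S"
  shows "accepts A (contexts_aut A L f S) (lang_functor L)"
  unfolding contexts_aut_def
proof (rule accepts_mk_aut)
  fix x assume "x \<in> S"
  then obtain C where C: "C \<in> all_ctxs" "x = f C" using assms(1) by blast
  \<comment> \<open>True because \<open>C\<close> consists of pairs of words over \<open>A\<close>;
    \<open>contexts_act\<close> would drop any others.\<close>
  then have "contexts_act A [] [] C = C" by (auto simp: contexts_act_def)
  with C show "f (contexts_act A [] [] (inv_into all_ctxs f x)) = x"
    by (simp only: inv)
next
  fix u v u' v' x
  assume uv: "u \<in> lists A" "v \<in> lists A" "u' \<in> lists A" "v' \<in> lists A" and "x \<in> S"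
  have "contexts_act A u' v' (contexts_act A u v C) = contexts_act A (u' @ u) (v @ v') C" for C
    using uv by (auto simp: contexts_act_def)
  then show "f (contexts_act A u' v' (inv_into all_ctxs f
        (f (contexts_act A u v (inv_into all_ctxs f x))))) =
      f (contexts_act A (u' @ u) (v @ v') (inv_into all_ctxs f x))"
    by (simp only: inv[OF contexts_act_in])
next
  fix u v w assume "u \<in> lists A" "v \<in> lists A" "w \<in> lists A"
  then show "f (contexts_act A u v (inv_into all_ctxs f (f (contexts A L w)))) =
      f (contexts A L (u @ w @ v))"
    by (simp only: inv[OF contexts_in] contexts_act_contexts)
next
  fix w assume "w \<in> lists A"
  have "f (contexts A L w) \<in> f ` {C \<in> all_ctxs. ([], []) \<in> C} \<longleftrightarrow>
      contexts A L w \<in> {C \<in> all_ctxs. ([], []) \<in> C}"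
    by (rule inj_on_image_mem_iff[OF inj contexts_in]) blast
  then show "f (contexts A L w) \<in> f ` {C \<in> all_ctxs. ([], []) \<in> C} \<longleftrightarrow> w \<in> L"
    using contexts_in[of A L w] by (simp add: contexts_def)
qed (use assms in blast)+

text \<open>Acting by \<open>(u, v)\<close> moves the pair \<open>(u, v)\<close> to the empty
  context, where acceptance is tested. So a coded set is the set of contexts that accept it.\<close>

lemma ob_contexts_aut:
  assumes "f C \<in> S" "C \<in> all_ctxs" "u \<in> lists A" "v \<in> lists A"
  shows "ob (contexts_aut A L f S) u v (f C) = (if (u, v) \<in> C then 1 else 0)"
proof -
  have "f (contexts_act A u v C) \<in> f ` {C \<in> all_ctxs. ([], []) \<in> C} \<longleftrightarrow>
      contexts_act A u v C \<in> {C \<in> all_ctxs. ([], []) \<in> C}"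
    by (rule inj_on_image_mem_iff[OF inj contexts_act_in]) blast
  then show ?thesis
    using contexts_act_in[of A u v C] assms inv[OF assms(2)]
    by (simp add: contexts_aut_def mk_aut_sel contexts_act_def)
qed

lemma contexts_aut_separated:
  assumes "S \<subseteq> f ` all_ctxs" "x \<in> S" "y \<in> S"
    and eq: "\<And>u v. u \<in> lists A \<Longrightarrow> v \<in> lists A \<Longrightarrow>
      ob (contexts_aut A L f S) u v x = ob (contexts_aut A L f S) u v y"
  shows "x = y"
proof -
  obtain C D where CD: "C \<in> all_ctxs" "D \<in> all_ctxs" "x = f C" "y = f D"
    using subsetD[OF assms(1,2)] subsetD[OF assms(1,3)] by (elim imageE) metis
  have "(u, v) \<in> C \<longleftrightarrow> (u, v) \<in> D" if "u \<in> lists A" "v \<in> lists A" for u v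
    using eq[OF that] that CD assms(2,3) by (simp add: ob_contexts_aut split: if_splits)
  then have "C = D" using CD(1,2) by blast
  with CD show "x = y" by simp
qed

lemma is_final_contexts_aut:
  "is_final_automaton A (lang_functor L) (contexts_aut A L f (f ` all_ctxs))"
  unfolding is_final_automaton_iff
proof (intro conjI allI impI)
  let ?F = "contexts_aut A L f (f ` all_ctxs)"
  show acc: "accepts A ?F (lang_functor L)"
    by (rule accepts_contexts_aut[OF subset_refl]) (intro imageI contexts_in contexts_act_in)+
  have S: "fob ?F States = f ` all_ctxs" and st: "\<And>w. st ?F w = f (contexts A L w)"
    by (simp_all add: contexts_aut_def mk_aut_sel)
  have ct: "ct ?F u v (f C) = f (contexts_act A u v C)" if "C \<in> all_ctxs" for u v C
  proof -
    have "f C \<in> f ` all_ctxs" using that by blast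
    with inv[OF that] show ?thesis
      by (simp add: contexts_aut_def mk_aut_sel)
  qed
  fix B :: "('a, 'u) set_func" assume B: "accepts A B (lang_functor L)"
  \<comment> \<open>Preservation of observations forces this choice: by
    \<open>ob_contexts_aut\<close>, the image of \<open>x\<close> must code the contexts in which
    \<open>x\<close> yields \<open>1\<close>.\<close>
  let ?C = "\<lambda>x. {(u, v). u \<in> lists A \<and> v \<in> lists A \<and> ob B u v x = 1}"
  let ?h = "\<lambda>x\<in>fob B States. f (?C x)"
  have C_in: "?C x \<in> all_ctxs" for x
    by auto
  have h_range: "?h \<in> fob B States \<rightarrow>\<^sub>E fob ?F States"
    unfolding S restrict_PiE_iff using C_in by blast
  show "\<exists>!h. aut_map A B ?F h"
  proof (rule ex1I)
    show h_map: "aut_map A B ?F ?h"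
    proof (rule aut_mapI[OF h_range])
      fix w assume w: "w \<in> lists A"
      have "?C (st B w) = contexts A L w"
        by (auto simp: contexts_def ob_st[OF B _ _ w] split: if_splits)
      then show "?h (st B w) = st ?F w"
        by (simp add: st st_closed[OF B w])
    next
      fix u v x assume uvx: "u \<in> lists A" "v \<in> lists A" "x \<in> fob B States"
      have "?C (ct B u v x) = contexts_act A u v (?C x)"
        using uvx by (auto simp: contexts_act_def ob_ct[OF B])
      then show "?h (ct B u v x) = ct ?F u v (?h x)"
        by (simp only: restrict_apply' uvx(3) ct_closed[OF B uvx] ct[OF C_in])
      have "f (?C x) \<in> f ` all_ctxs" using C_in by blast
      then have "ob ?F u v (f (?C x)) = (if (u, v) \<in> ?C x then 1 else 0)"
        by (rule ob_contexts_aut[OF _ C_in uvx(1,2)])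
      then show "ob B u v x = ob ?F u v (?h x)"
        using ob_range[OF B uvx] uvx by auto
    qed
    fix h assume h: "aut_map A B ?F h"
    show "h = ?h"
    proof (rule PiE_ext[OF aut_mapD(1)[OF h] h_range])
      fix x assume x: "x \<in> fob B States"
      \<comment> \<open>Both maps preserve observations, and these tell the states of the model
        apart.\<close>
      show "h x = ?h x"
      proof (rule contexts_aut_separated[OF subset_refl])
        show "h x \<in> f ` all_ctxs" using aut_mapD(2)[OF h x] by (simp only: S)
        show "?h x \<in> f ` all_ctxs" using aut_mapD(2)[OF h_map x] by (simp only: S)
        show "ob ?F u v (h x) = ob ?F u v (?h x)" if "u \<in> lists A" "v \<in> lists A" for u v
          using aut_mapD(5)[OF h that x] aut_mapD(5)[OF h_map that x] by argo
      qed
    qed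
  qed
qed

end

section \<open>The minimal automaton\<close>

text \<open>The universe is only known to have room for sets of contexts; a word finds its place
  there as a singleton.\<close>

lemma inj_on_words:
  assumes "inj_on f (Pow (lists A \<times> lists A))"
  shows "inj_on (\<lambda>w. f {(w, [])}) (lists A)"
proof (rule inj_onI)
  fix v w assume vw: "v \<in> lists A" "w \<in> lists A" "f {(v, [])} = f {(w, [])}"
  then have "{(v, []::'a list)} = {(w, [])}"
    by (intro inj_onD[OF assms]) auto
  then show "v = w" by simp
qed

text \<open>The map from \<open>I\<close> to the automaton of words, followed by the map back, is
  the only endomorphism of \<open>I\<close>, the identity. So \<open>x\<close> is the image of a
  word state, and the map back sends that state to \<open>st I w\<close>.\<close>

lemma initial_automaton_reachable:
  fixes I :: "('a, 'u::zero_neq_one) set_func"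
  assumes I: "is_initial_automaton A (lang_functor L) I"
    and univ: "large_universe A TYPE('u)"
    and x: "x \<in> fob I States"
  shows "x \<in> st I ` lists A"
proof -
  obtain f :: "('a list \<times> 'a list) set \<Rightarrow> 'u" where "inj_on f (Pow (lists A \<times> lists A))"
    using univ by (auto simp: large_universe_def)
  from inj_on_words[OF this] obtain i :: "'a list \<Rightarrow> 'u" where i: "inj_on i (lists A)"
    by blast
  let ?W = "words_aut A L i"
  have accI: "accepts A I (lang_functor L)" and unique: "\<exists>!h. aut_map A I I h"
    using I by (auto simp: is_initial_automaton_iff)
  obtain h where h: "aut_map A I ?W h"
    using I accepts_words_aut[OF i] unfolding is_initial_automaton_iff by metis
  obtain k where k: "aut_map A ?W I k"
    using is_initial_words_aut[OF i] accI unfolding is_initial_automaton_iff by metis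
  have "compose (fob I States) k h = (\<lambda>x\<in>fob I States. x)"
    using unique aut_map_compose[OF accI h k] aut_map_id[OF accI] by blast
  then have "k (h x) = x"
    using x by (auto simp: compose_def fun_eq_iff split: if_splits)
  moreover obtain w where "w \<in> lists A" "h x = st ?W w"
    using aut_mapD(2)[OF h x] by (auto simp: words_aut_def mk_aut_sel)
  ultimately show ?thesis
    using aut_mapD(3)[OF k] by (metis imageI)
qed

text \<open>Dually, the map from \<open>F\<close> to the context model has a left inverse. It
  preserves observations, which separate states in the model, so \<open>x\<close> and
  \<open>y\<close> have the same image and coincide.\<close>

lemma final_automaton_separated:
  fixes F :: "('a, 'u::zero_neq_one) set_func"
  assumes F: "is_final_automaton A (lang_functor L) F"
    and univ: "large_universe A TYPE('u)"
    and xy: "x \<in> fob F States" "y \<in> fob F States"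
    and eq: "\<And>u v. u \<in> lists A \<Longrightarrow> v \<in> lists A \<Longrightarrow> ob F u v x = ob F u v y"
  shows "x = y"
proof -
  obtain f :: "('a list \<times> 'a list) set \<Rightarrow> 'u" where f: "inj_on f (Pow (lists A \<times> lists A))"
    using univ by (auto simp: large_universe_def)
  let ?S = "f ` Pow (lists A \<times> lists A)"
  let ?C = "contexts_aut A L f ?S"
  have accF: "accepts A F (lang_functor L)" and unique: "\<exists>!h. aut_map A F F h"
    using F by (auto simp: is_final_automaton_iff)
  obtain h where h: "aut_map A F ?C h"
    using is_final_contexts_aut[OF f] accF unfolding is_final_automaton_iff by metis
  obtain k where k: "aut_map A ?C F k"
    using F is_final_contexts_aut[OF f] unfolding is_final_automaton_iff by metis
  have "compose (fob F States) k h = (\<lambda>x\<in>fob F States. x)"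
    using unique aut_map_compose[OF accF h k] aut_map_id[OF accF] by blast
  then have kh: "k (h z) = z" if "z \<in> fob F States" for z
    using that by (auto simp: compose_def fun_eq_iff split: if_splits)
  have S: "fob ?C States = ?S"
    by (simp add: contexts_aut_def mk_aut_sel)
  have "h x = h y"
  proof (rule contexts_aut_separated[OF f subset_refl])
    show "h x \<in> ?S" "h y \<in> ?S"
      using aut_mapD(2)[OF h] xy S by metis+
    show "ob ?C u v (h x) = ob ?C u v (h y)" if "u \<in> lists A" "v \<in> lists A" for u v
      using eq[OF that] aut_mapD(5)[OF h that] xy by metis
  qed
  then show ?thesis
    using kh xy by metis
qed

section \<open>Reachability and separation through the factorization\<close>

lemma is_Min_accepts: "is_Min A \<L> M \<Longrightarrow> accepts A M \<L>"
  by (simp add: is_Min_def)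

text \<open>Reachability passes forward along the surjective \<open>e\<close>, which preserves
  \<open>st\<close>; separation passes back along the injective \<open>m\<close>, which preserves
  \<open>ob\<close>.\<close>

lemma is_Min_states:
  fixes M :: "('a, 'u::zero_neq_one) set_func"
  assumes M: "is_Min A (lang_functor L) M" and univ: "large_universe A TYPE('u)"
  shows is_Min_reachable: "fob M States = st M ` lists A"
    and is_Min_separated: "\<And>x y. x \<in> fob M States \<Longrightarrow> y \<in> fob M States \<Longrightarrow>
      (\<And>u v. u \<in> lists A \<Longrightarrow> v \<in> lists A \<Longrightarrow> ob M u v x = ob M u v y) \<Longrightarrow> x = y"
proof -
  obtain I F e m where I: "is_initial_automaton A (lang_functor L) I"
    and F: "is_final_automaton A (lang_functor L) F"
    and e: "is_aut_morphism A I M e" and m: "is_aut_morphism A M F m"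
    and surj: "sapp (e States) ` fob I States = fob M States"
    and inj: "inj_on (sapp (m States)) (fob M States)"
    using M unfolding is_Min_def by (auto simp: I_Mon_sel)
  have accM: "accepts A M (lang_functor L)"
    and accI: "accepts A I (lang_functor L)" and accF: "accepts A F (lang_functor L)"
    using M I F by (simp_all add: is_Min_def is_initial_automaton_def is_final_automaton_def)
  note e = aut_morphism_imp_aut_map(1)[OF accI accM e]
  note m = aut_morphism_imp_aut_map(1)[OF accM accF m]
  have "fob I States = st I ` lists A"
    using initial_automaton_reachable[OF I univ] st_closed[OF accI] by blast
  then show "fob M States = st M ` lists A"
    unfolding surj[symmetric] by (auto simp: image_image aut_mapD(3)[OF e])
  fix x y assume xy: "x \<in> fob M States" "y \<in> fob M States"
    and eq: "\<And>u v. u \<in> lists A \<Longrightarrow> v \<in> lists A \<Longrightarrow> ob M u v x = ob M u v y"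
  have "sapp (m States) x = sapp (m States) y"
  proof (rule final_automaton_separated[OF F univ])
    show "sapp (m States) x \<in> fob F States" "sapp (m States) y \<in> fob F States"
      using aut_mapD(2)[OF m] xy by blast+
    show "ob F u v (sapp (m States) x) = ob F u v (sapp (m States) y)"
      if "u \<in> lists A" "v \<in> lists A" for u v
      using eq[OF that] aut_mapD(5)[OF m that] xy by metis
  qed
  with inj xy show "x = y"
    by (simp add: inj_on_eq_iff)
qed

text \<open>Guarantees that a statement about every minimal automaton is not vacuous.\<close>

lemma ex_is_Min:
  fixes A :: "'a set"
  assumes univ: "large_universe A TYPE('u::zero_neq_one)"
  shows "\<exists>M :: ('a, 'u) set_func. is_Min A (lang_functor L) M"
proof -
  obtain f :: "('a list \<times> 'a list) set \<Rightarrow> 'u" where f: "inj_on f (Pow (lists A \<times> lists A))"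
    using univ by (auto simp: large_universe_def)
  let ?i = "\<lambda>w. f {(w, [])}"
  \<comment> \<open>The image of the morphism from words to sets of contexts.\<close>
  let ?S = "(\<lambda>w. f (contexts A L w)) ` lists A"
  let ?I = "words_aut A L ?i"
  let ?F = "contexts_aut A L f (f ` Pow (lists A \<times> lists A))"
  let ?M = "contexts_aut A L f ?S"
  note I = is_initial_words_aut[OF inj_on_words[OF f], of L]
  note F = is_final_contexts_aut[OF f, of L]
  have S: "?S \<subseteq> f ` Pow (lists A \<times> lists A)"
    using contexts_in by blast
  have accM: "accepts A ?M (lang_functor L)"
  proof (rule accepts_contexts_aut[OF f S])
    fix u v x assume uv: "u \<in> lists A" "v \<in> lists A" and "x \<in> ?S"
    then obtain w where w: "w \<in> lists A" "x = f (contexts A L w)"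
      by blast
    then have "f (contexts_act A u v (inv_into (Pow (lists A \<times> lists A)) f x)) =
        f (contexts A L (u @ w @ v))"
      using contexts_act_contexts[OF uv] inv_into_f_f[OF f contexts_in] by metis
    then show "f (contexts_act A u v (inv_into (Pow (lists A \<times> lists A)) f x)) \<in> ?S"
      using uv w(1) by auto
  qed blast
  have accI: "accepts A ?I (lang_functor L)" and accF: "accepts A ?F (lang_functor L)"
    using I F by (simp_all add: is_initial_automaton_def is_final_automaton_def)
  obtain e where e: "aut_map A ?I ?M e"
    using I accM unfolding is_initial_automaton_iff by metis
  obtain m where m: "aut_map A ?M ?F m"
    using F accM unfolding is_final_automaton_iff by metis
  have states: "fob ?M States = ?S" "fob ?I States = st ?I ` lists A"
    and st_M: "\<And>w. st ?M w = f (contexts A L w)"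
    by (simp_all add: contexts_aut_def words_aut_def mk_aut_sel)
  have surj: "e ` fob ?I States = fob ?M States"
    unfolding states by (auto simp: image_image aut_mapD(3)[OF e] st_M)
  \<comment> \<open>\<open>m\<close> preserves observations, and the states of \<open>?M\<close> are
    already told apart by theirs.\<close>
  have inj: "inj_on m (fob ?M States)"
  proof (rule inj_onI, rule contexts_aut_separated[OF f S])
    fix x y assume xy: "x \<in> fob ?M States" "y \<in> fob ?M States" and eq: "m x = m y"
    then show "x \<in> ?S" "y \<in> ?S" by (simp_all only: states)
    show "ob ?M u v x = ob ?M u v y" if "u \<in> lists A" "v \<in> lists A" for u v
      using aut_mapD(5)[OF m that xy(1)] aut_mapD(5)[OF m that xy(2)] eq by argo
  qed
  have obj: "fob F In = one_set" "fob F Out = two_set"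
    if "accepts A F (lang_functor L)" for F :: "('a, 'u) set_func"
    using that by (simp_all add: accepts_def is_automaton_def)
  \<comment> \<open>Taking the composite as the morphism from initial to final makes the
    factorization hold by construction.\<close>
  let ?h = "compose (fob ?I States) m e"
  have "is_Min A (lang_functor L) ?M"
    unfolding is_Min_def
  proof (intro conjI exI ballI accM)
    show "is_initial_automaton A (lang_functor L) ?I" by (rule I)
    show "is_final_automaton A (lang_functor L) ?F" by (rule F)
    show "is_aut_morphism A ?I ?F (aut_mor ?I ?F ?h)"
      by (rule is_aut_morphism_aut_mor[OF accI accF aut_map_compose[OF accI e m]])
    show "is_aut_morphism A ?I ?M (aut_mor ?I ?M e)"
      by (rule is_aut_morphism_aut_mor[OF accI accM e])
    show "is_aut_morphism A ?M ?F (aut_mor ?M ?F m)"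
      by (rule is_aut_morphism_aut_mor[OF accM accF m])
    fix X
    show "aut_mor ?I ?F ?h X = cmp Set_cat (aut_mor ?M ?F m X) (aut_mor ?I ?M e X)"
      by (cases X) (auto simp: Set_cat_sel compose_def fun_eq_iff)
    show "sapp (aut_mor ?I ?M e X) ` fob ?I X = fob ?M X"
      by (cases X) (simp_all add: surj obj[OF accI] obj[OF accM] Set_cat_sel)
    show "inj_on (sapp (aut_mor ?M ?F m X)) (fob ?M X)"
      by (cases X) (simp_all add: inj obj[OF accM] Set_cat_sel)
  qed
  then show ?thesis by blast
qed

section \<open>The syntactic monoid\<close>

lemma syn_class_eq_iff:
  assumes "w \<in> lists A" "w' \<in> lists A"
  shows "syn_class A L w = syn_class A L w' \<longleftrightarrow>
    (\<forall>u\<in>lists A. \<forall>v\<in>lists A. u @ w @ v \<in> L \<longleftrightarrow> u @ w' @ v \<in> L)"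
proof
  assume "syn_class A L w = syn_class A L w'"
  moreover have "w \<in> syn_class A L w"
    using assms by (simp add: syn_class_def syn_cong_def)
  ultimately show "\<forall>u\<in>lists A. \<forall>v\<in>lists A. u @ w @ v \<in> L \<longleftrightarrow> u @ w' @ v \<in> L"
    by (simp add: syn_class_def syn_cong_def)
qed (use assms in \<open>auto simp: syn_class_def syn_cong_def\<close>)

lemma mem_syn_class:
  assumes "w \<in> lists A"
  shows "x \<in> syn_class A L w \<longleftrightarrow> x \<in> lists A \<and> syn_class A L x = syn_class A L w"
proof
  assume "x \<in> syn_class A L w"
  then show "x \<in> lists A \<and> syn_class A L x = syn_class A L w"
    using assms by (auto simp: syn_class_def syn_cong_def)
qed (use assms in \<open>auto simp: syn_class_def syn_cong_def\<close>)

text \<open>One factor is replaced at a time while the other is absorbed into the context: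
  \<open>y\<close> on the right, then \<open>x'\<close> on the left.\<close>

lemma syn_class_append:
  assumes "x \<in> lists A" "x' \<in> lists A" "y \<in> lists A" "y' \<in> lists A"
    and "syn_class A L x = syn_class A L x'" "syn_class A L y = syn_class A L y'"
  shows "syn_class A L (x @ y) = syn_class A L (x' @ y')"
proof -
  have "u @ (x @ y) @ v \<in> L \<longleftrightarrow> u @ (x' @ y') @ v \<in> L" if uv: "u \<in> lists A" "v \<in> lists A" for u v
  proof -
    have "u @ x @ (y @ v) \<in> L \<longleftrightarrow> u @ x' @ (y @ v) \<in> L"
      using assms uv by (simp add: syn_class_eq_iff)
    moreover have "(u @ x') @ y @ v \<in> L \<longleftrightarrow> (u @ x') @ y' @ v \<in> L"
      using assms uv by (simp add: syn_class_eq_iff del: append_assoc)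
    ultimately show ?thesis by simp
  qed
  then show ?thesis
    using assms(1-4) by (simp add: syn_class_eq_iff)
qed

lemma carrier_Syn: "carrier (Syn A L) = syn_class A L ` lists A"
  by (auto simp: Syn_def syn_class_def quotient_def)

text \<open>By \<open>syn_class_append\<close> all members of the union defining the product
  coincide, and the union is over nonempty classes.\<close>

lemma mult_Syn:
  assumes "x \<in> lists A" "y \<in> lists A"
  shows "syn_class A L x \<otimes>\<^bsub>Syn A L\<^esub> syn_class A L y = syn_class A L (x @ y)"
proof -
  have eq: "syn_class A L (x' @ y') = syn_class A L (x @ y)"
    if "x' \<in> syn_class A L x" "y' \<in> syn_class A L y" for x' y'
    by (rule syn_class_append) (use that assms in \<open>simp_all add: mem_syn_class\<close>)
  have "syn_class A L x \<otimes>\<^bsub>Syn A L\<^esub> syn_class A L y =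
      (\<Union>x'\<in>syn_class A L x. \<Union>y'\<in>syn_class A L y. syn_class A L (x @ y))"
    by (simp add: Syn_def eq cong: SUP_cong_simp)
  moreover have "x \<in> syn_class A L x" "y \<in> syn_class A L y"
    using assms by (simp_all add: mem_syn_class)
  ultimately show ?thesis by auto
qed

lemma one_Syn: "\<one>\<^bsub>Syn A L\<^esub> = syn_class A L []"
  by (simp add: Syn_def)

lemma monoid_Syn: "monoid (Syn A L)"
  by unfold_locales (auto simp: carrier_Syn mult_Syn one_Syn)

lemma is_monoid_recognizer_Syn:
  assumes "L \<subseteq> lists A"
  shows "is_monoid_recognizer A (Syn A L) (syn_class A L) (syn_class A L ` L)"
  unfolding is_monoid_recognizer_def
proof (intro conjI monoid_Syn)
  show "syn_class A L \<in> hom (free_mon A) (Syn A L)"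
    by (auto simp: hom_def free_mon_def mult_Syn carrier_Syn)
  show "syn_class A L \<one>\<^bsub>free_mon A\<^esub> = \<one>\<^bsub>Syn A L\<^esub>"
    by (simp add: free_mon_def one_Syn)
  show "syn_class A L ` L \<subseteq> carrier (Syn A L)"
    using assms by (auto simp: carrier_Syn)
qed

section \<open>Comparison of recognizers\<close>

lemma syn_class_in_image_iff:
  assumes "L \<subseteq> lists A" "w \<in> lists A"
  shows "syn_class A L w \<in> syn_class A L ` L \<longleftrightarrow> w \<in> L"
proof
  assume "syn_class A L w \<in> syn_class A L ` L"
  then obtain w' where "w' \<in> L" "syn_class A L w = syn_class A L w'"
    by blast
  \<comment> \<open>The empty context shows that \<open>L\<close> is a union of classes.\<close>
  moreover from this have "[] @ w @ [] \<in> L \<longleftrightarrow> [] @ w' @ [] \<in> L"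
    using assms syn_class_eq_iff[of w A w' L] by blast
  ultimately show "w \<in> L" by simp
qed blast

text \<open>Images of words exhaust both recognizers, so words dictate the maps in both directions;
  these are well defined and mutually inverse because the two kernels agree.\<close>

lemma recognizer_iso_surj:
  assumes R: "rset R = rmap R ` lists A"
      "\<And>u w. u \<in> lists A \<Longrightarrow> w \<in> lists A \<Longrightarrow> lact R u (rmap R w) = rmap R (u @ w)"
      "\<And>u w. u \<in> lists A \<Longrightarrow> w \<in> lists A \<Longrightarrow> ract R (rmap R w) u = rmap R (w @ u)"
      "racc R \<subseteq> rset R"
    and S: "rset S = rmap S ` lists A"
      "\<And>u w. u \<in> lists A \<Longrightarrow> w \<in> lists A \<Longrightarrow> lact S u (rmap S w) = rmap S (u @ w)"
      "\<And>u w. u \<in> lists A \<Longrightarrow> w \<in> lists A \<Longrightarrow> ract S (rmap S w) u = rmap S (w @ u)"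
      "racc S \<subseteq> rset S"
    and eq: "\<And>w w'. w \<in> lists A \<Longrightarrow> w' \<in> lists A \<Longrightarrow>
      rmap R w = rmap R w' \<longleftrightarrow> rmap S w = rmap S w'"
    and acc: "\<And>w. w \<in> lists A \<Longrightarrow> rmap R w \<in> racc R \<longleftrightarrow> rmap S w \<in> racc S"
  shows "recognizer_iso A R S"
proof -
  \<comment> \<open>Every element is the image of a word, so the laws come down to associativity of
    append.\<close>
  have rec: "is_recognizer A R" "is_recognizer A S"
    unfolding is_recognizer_def is_biaction_def is_biaction_morphism_def
    using R(4) S(4) by (auto simp: R(1-3) S(1-3))
  \<comment> \<open>Any word representing \<open>x\<close> will do: by \<open>eq\<close> the result
    does not depend on the choice.\<close>
  define h where "h x = rmap S (SOME w. w \<in> lists A \<and> rmap R w = x)" for x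
  define k where "k y = rmap R (SOME w. w \<in> lists A \<and> rmap S w = y)" for y
  have h: "h (rmap R w) = rmap S w" if "w \<in> lists A" for w
    unfolding h_def using someI[of "\<lambda>v. v \<in> lists A \<and> rmap R v = rmap R w" w] eq that by blast
  have k: "k (rmap S w) = rmap R w" if "w \<in> lists A" for w
    unfolding k_def using someI[of "\<lambda>v. v \<in> lists A \<and> rmap S v = rmap S w" w] eq that by blast
  have "is_recognizer_morphism A R S h" "is_recognizer_morphism A S R k"
    unfolding is_recognizer_morphism_def is_biaction_morphism_def
    by (auto simp: R(1-3) S(1-3) h k acc)
  moreover have "\<forall>x\<in>rset R. k (h x) = x" "\<forall>y\<in>rset S. h (k y) = y"
    by (auto simp: R(1) S(1) h k)
  ultimately show ?thesis
    using rec unfolding recognizer_iso_def by blast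
qed

lemma recognizer_iso_Min_Syn:
  fixes M :: "('a, 'u::zero_neq_one) set_func"
  assumes L: "L \<subseteq> lists A" and univ: "large_universe A TYPE('u)"
    and M: "is_Min A (lang_functor L) M"
  shows "recognizer_iso A (recognizer_of M)
    (underlying_recognizer (Syn A L) (syn_class A L) (syn_class A L ` L))"
proof -
  note acc = is_Min_accepts[OF M]
  have R: "rset (recognizer_of M) = fob M States"
    "lact (recognizer_of M) u x = ct M u [] x"
    "ract (recognizer_of M) x u = ct M [] u x"
    "rmap (recognizer_of M) w = st M w"
    "x \<in> racc (recognizer_of M) \<longleftrightarrow> x \<in> fob M States \<and> ob M [] [] x = 1" for u w x
    by (simp_all add: recognizer_of_def st_def ct_def ob_def)
  have eq: "st M w = st M w' \<longleftrightarrow> syn_class A L w = syn_class A L w'"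
    if w: "w \<in> lists A" "w' \<in> lists A" for w w'
  proof -
    have "st M w = st M w' \<longleftrightarrow>
        (\<forall>u\<in>lists A. \<forall>v\<in>lists A. ob M u v (st M w) = ob M u v (st M w'))"
      using is_Min_separated[OF M univ] st_closed[OF acc] w by metis
    \<comment> \<open>The observations of \<open>st M w\<close> record which words
      \<open>u @ w @ v\<close> lie in \<open>L\<close>; as \<open>0\<close> and \<open>1\<close>
      differ, equal observations mean equal membership.\<close>
    also have "\<dots> \<longleftrightarrow> syn_class A L w = syn_class A L w'"
      using w by (simp add: ob_st[OF acc] syn_class_eq_iff) blast
    finally show ?thesis .
  qed
  show ?thesis
  proof (rule recognizer_iso_surj)
    show "rset (recognizer_of M) = rmap (recognizer_of M) ` lists A"
      using is_Min_reachable[OF M univ] by (simp add: R)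
    show "racc (recognizer_of M) \<subseteq> rset (recognizer_of M)"
      by (auto simp: R)
  qed (use L in \<open>auto simp: R eq ct_st[OF acc] ob_st[OF acc] st_closed[OF acc]
      underlying_recognizer_def carrier_Syn mult_Syn syn_class_in_image_iff\<close>)
qed

theorem theorem6p9:
  fixes A :: "'a set" and L :: "'a list set"
  assumes "L \<subseteq> lists A"
    and "large_universe A TYPE('u::zero_neq_one)"
  shows "(\<exists>M :: ('a, 'u) set_func. is_Min A (lang_functor L) M) \<and>
    is_monoid_recognizer A (Syn A L) (syn_class A L) (syn_class A L ` L) \<and>
    (\<forall>M :: ('a, 'u) set_func. is_Min A (lang_functor L) M \<longrightarrow>
       recognizer_iso A (recognizer_of M)
         (underlying_recognizer (Syn A L) (syn_class A L) (syn_class A L ` L)))"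
  using ex_is_Min[OF assms(2)] is_monoid_recognizer_Syn[OF assms(1)]
    recognizer_iso_Min_Syn[OF assms] by blast

end
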